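(* Let $d\ge 4$ and $0<\alpha\le d$. Then $$\beta_d(\alpha)\le \alpha-1+\frac{2(d-\alpha)}{d},$$ where $\beta_d(\alpha)$ is the optimal decay exponent, defined in the context, for the spherical $L^2$-averages of the Fourier transform of $\alpha$-dimensional measures on $\mathbb{R}^d$.
   Context: Let $0<\alpha\le d$. A measure $\mu$ is called $\alpha$-dimensional if it is a positive Borel measure on $\mathbb{R}^d$, supported in the unit ball $B(0,1)$, such that $$c_\alpha(\mu):=\sup_{x\in\mathbb{R}^d,\ r>0}\frac{\mu(B(x,r))}{r^\alpha}<\infty .$$ Write $\|\mu\|=\mu(\mathbb{R}^d)$, and $\widehat\mu(\xi)=(2\pi)^{-d/2}\int e^{-ix\cdot\xi}\,d\mu(x)$. $L^2(\mathbb{S}^{d-1})$ is taken with respect to surface measure on the unit sphere. $\beta_d(\alpha)$ denotes the supremum of the numbers $\beta$ for which there is a constant $C$ (independent of $R$ and $\mu$) such that $$\|\widehat{\mu}(R\,\cdot\,)\|^2_{L^2(\mathbb{S}^{d-1})}\le C\,c_{\alpha}(\mu)\,\|\mu\|\,R^{-\beta}$$ for all $R>1$ and all $\alpha$-dimensional measures $\mu$. *)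

theory Defs
  imports "HOL-Analysis.Analysis"
begin

definition measure_support :: "'a::euclidean_space measure \<Rightarrow> 'a set" where
  "measure_support \<mu> = {x. \<forall>U. open U \<and> x \<in> U \<longrightarrow> emeasure \<mu> U > 0}"

definition c_dim :: "real \<Rightarrow> 'a::euclidean_space measure \<Rightarrow> ennreal" where
  "c_dim \<alpha> \<mu> = (SUP x. SUP r\<in>{0<..}. emeasure \<mu> (ball x r) / ennreal (r powr \<alpha>))"

definition alpha_dimensional :: "real \<Rightarrow> 'a::euclidean_space measure \<Rightarrow> bool" where
  "alpha_dimensional \<alpha> \<mu> \<longleftrightarrow>
     sets \<mu> = sets borel \<and> measure_support \<mu> \<subseteq> ball 0 1 \<and> c_dim \<alpha> \<mu> < \<infinity>"

(* Complex-valued Bochner integral. For alpha-dimensional measures the integrand is bounded and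
   the measure finite, so the integral always exists. *)
definition fourier_measure :: "'a::euclidean_space measure \<Rightarrow> 'a \<Rightarrow> complex" where
  "fourier_measure \<mu> \<xi> =
     complex_of_real ((2 * pi) powr (- real DIM('a) / 2)) *
     (LINT x|\<mu>. exp (- (\<i> * complex_of_real (x \<bullet> \<xi>))))"

(* Surface measure via polar coordinates: the measure of a Borel set E of the sphere is d times
   the Lebesgue measure of the cone {t *\<^sub>R w | w \<in> E, 0 < t < 1}. *)
definition sphere_measure :: "'a::euclidean_space measure" where
  "sphere_measure =
     distr (scale_measure (of_nat DIM('a)) (restrict_space lborel (ball 0 1 - {0})))
       (restrict_space borel (sphere 0 1)) (\<lambda>x. x /\<^sub>R norm x)"

definition sphere_L2_sq :: "('a::euclidean_space \<Rightarrow> complex) \<Rightarrow> ennreal" where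
  "sphere_L2_sq f = (\<integral>\<^sup>+ \<omega>. ennreal ((cmod (f \<omega>))\<^sup>2) \<partial>sphere_measure)"

(* The first argument only selects the ambient space. *)
definition decay_admissible :: "'a::euclidean_space itself \<Rightarrow> real \<Rightarrow> real \<Rightarrow> bool" where
  "decay_admissible T \<alpha> \<beta> \<longleftrightarrow>
     (\<exists>C::real. \<forall>R::real. \<forall>\<mu>::'a measure. R > 1 \<longrightarrow> alpha_dimensional \<alpha> \<mu> \<longrightarrow>
        sphere_L2_sq (\<lambda>\<omega>. fourier_measure \<mu> (R *\<^sub>R \<omega>))
          \<le> ennreal C * c_dim \<alpha> \<mu> * emeasure \<mu> UNIV * ennreal (R powr (- \<beta>)))"

(* The supremum is taken in the extended reals, so it is meaningful without first showing that
   the admissible exponents are bounded above. *)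
definition beta_exponent :: "'a::euclidean_space itself \<Rightarrow> real \<Rightarrow> ereal" where
  "beta_exponent T \<alpha> = (SUP \<beta>\<in>{\<beta>. decay_admissible T \<alpha> \<beta>}. ereal \<beta>)"

end

theory Submission
  imports Defs
begin

text \<open>
  Arrange about \<open>N ^ d\<close> points of spacing \<open>1 / (2 d N)\<close> in the unit ball and let the measure be Lebesgue
  measure on the balls of radius \<open>1 / (2 R)\<close> around them. With \<open>N ^ d\<close> of order \<open>R powr \<alpha>\<close>, the
  normalised measure is \<open>\<alpha>\<close>-dimensional uniformly in \<open>R\<close>. Its Fourier transform is comparable to the
  total mass within distance 1/2 of every point of the dual lattice on the sphere of radius \<open>R\<close>,
  because all phases are there close to multiples of \<open>2 \<pi>\<close>. In units of the dual lattice
  that sphere has radius \<open>K\<close> of order \<open>R / N\<close>; the cube \<open>{K+1..2K} ^ d\<close> has \<open>K ^ d\<close> integer points but only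
  \<open>O(K ^ 2)\<close> values of \<open>norm l ^ 2\<close>, so some such sphere carries at least a constant times \<open>K ^ (d - 2)\<close> points.
  Each contributes a cap of measure \<open>R powr (1 - d)\<close>, and comparing powers of \<open>R\<close> bounds the decay exponent.
\<close>

section \<open>Counting points with prescribed coordinates\<close>

text \<open>Taking coordinates turns the box into a product of finite sets. This counts both the
  centres of the balls and the integer points of a cube.\<close>

lemma coordinate_box:
  assumes "\<And>b. b \<in> Basis \<Longrightarrow> finite (A b)"
  shows finite_coordinate_box: "finite {x::'a::euclidean_space. \<forall>b\<in>Basis. x \<bullet> b \<in> A b}"
    and card_coordinate_box:
      "card {x::'a. \<forall>b\<in>Basis. x \<bullet> b \<in> A b} = (\<Prod>b\<in>Basis. card (A b))"
proof -
  have bij: "bij_betw (\<lambda>x::'a. restrict (\<lambda>b. x \<bullet> b) Basis)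
      {x. \<forall>b\<in>Basis. x \<bullet> b \<in> A b} (PiE Basis A)"
  proof (rule bij_betw_byWitness[where f' = "\<lambda>f. \<Sum>b\<in>Basis. f b *\<^sub>R b"])
    show "\<forall>a'\<in>Pi\<^sub>E Basis A. restrict (\<lambda>b. (\<Sum>b\<in>Basis. a' b *\<^sub>R b) \<bullet> b) Basis = a'"
      by (auto simp: fun_eq_iff restrict_def PiE_def extensional_def)
  qed (auto simp: euclidean_representation)
  have fin: "finite (PiE (Basis::'a set) A)"
    using assms by (intro finite_PiE) auto
  show "finite {x::'a. \<forall>b\<in>Basis. x \<bullet> b \<in> A b}"
    using bij_betw_finite[OF bij] fin by blast
  show "card {x::'a. \<forall>b\<in>Basis. x \<bullet> b \<in> A b} = (\<Prod>b\<in>Basis. card (A b))"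
    using bij_betw_same_card[OF bij] by (simp add: card_PiE)
qed

lemma card_int_interval_le:
  fixes a b :: real
  assumes "a \<le> b"
  shows "real (card {k::int. a < k \<and> k < b}) \<le> b - a + 1"
proof -
  have "{k::int. a < k \<and> k < b} \<subseteq> {\<lfloor>a\<rfloor> + 1..\<lceil>b\<rceil> - 1}"
    by (auto; linarith)
  then have "card {k::int. a < k \<and> k < b} \<le> nat (\<lceil>b\<rceil> - 1 - \<lfloor>a\<rfloor>)"
    using card_mono[of "{\<lfloor>a\<rfloor> + 1..\<lceil>b\<rceil> - 1}"] by (auto simp: algebra_simps)
  then show ?thesis using assms by linarith
qed

section \<open>Surface measure of spherical caps\<close>

lemma emeasure_sphere_measure:
  assumes "X \<in> sets borel" "X \<subseteq> sphere (0::'a::euclidean_space) 1"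
  shows "emeasure sphere_measure X =
    of_nat DIM('a) * emeasure lborel {x \<in> ball 0 1 - {0}. x /\<^sub>R norm x \<in> X}"
proof -
  let ?M = "restrict_space lborel (ball (0::'a) 1 - {0})"
  have f: "(\<lambda>x. x /\<^sub>R norm x) \<in> measurable ?M (restrict_space borel (sphere 0 1))"
    by (intro measurable_restrict_space2 measurable_restrict_space1) (auto simp: space_restrict_space)
  have X: "X \<in> sets (restrict_space borel (sphere 0 1))"
    using assms by (auto simp: sets_restrict_space_iff)
  have eq: "(\<lambda>x. x /\<^sub>R norm x) -` X \<inter> space (scale_measure (of_nat DIM('a)) ?M) =
      {x \<in> ball 0 1 - {0}. x /\<^sub>R norm x \<in> X}"
    by (auto simp: space_scale_measure space_restrict_space)
  have "(\<lambda>x. x /\<^sub>R norm x) \<in> measurable (scale_measure (of_nat DIM('a)) ?M)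
      (restrict_space borel (sphere 0 1))"
    using f by simp
  then have "emeasure sphere_measure X =
      of_nat DIM('a) * emeasure ?M {x \<in> ball 0 1 - {0}. x /\<^sub>R norm x \<in> X}"
    unfolding sphere_measure_def using X by (subst emeasure_distr) (simp_all only: eq emeasure_scale_measure)
  then show ?thesis
    by (subst (asm) emeasure_restrict_space) auto
qed

text \<open>Radial projection is Lipschitz away from the origin: passing from x / norm x to x / t,
  and from there to u, costs less than \<epsilon> / t each time, and t is at least 1/2. This keeps
  small balls inside the cone over a cap.\<close>

lemma norm_normalize_diff_le:
  fixes u x :: "'a::real_normed_vector"
  assumes "norm u = 1" "t \<ge> 1/2" "norm (x - t *\<^sub>R u) < \<epsilon>" "x \<noteq> 0"
  shows "norm (x /\<^sub>R norm x - u) < 4 * \<epsilon>"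
proof -
  have "\<bar>t - norm x\<bar> < \<epsilon>"
    using norm_triangle_ineq3[of x "t *\<^sub>R u"] assms by auto
  moreover have "x /\<^sub>R norm x - x /\<^sub>R t = ((t - norm x) / t) *\<^sub>R (x /\<^sub>R norm x)"
    using assms by (simp add: algebra_simps divide_simps flip: scaleR_diff_left)
  then have "norm (x /\<^sub>R norm x - x /\<^sub>R t) = \<bar>t - norm x\<bar> / t"
    using assms by (simp only: norm_scaleR) (simp add: abs_mult)
  moreover have "x /\<^sub>R t - u = (x - t *\<^sub>R u) /\<^sub>R t" using assms by (simp add: algebra_simps)
  then have "norm (x /\<^sub>R t - u) = norm (x - t *\<^sub>R u) / t" using assms by (simp add: divide_simps)
  moreover have "norm (x /\<^sub>R norm x - u) \<le> norm (x /\<^sub>R norm x - x /\<^sub>R t) + norm (x /\<^sub>R t - u)"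
    using norm_triangle_ineq[of "x /\<^sub>R norm x - x /\<^sub>R t" "x /\<^sub>R t - u"] by simp
  ultimately have "norm (x /\<^sub>R norm x - u) \<le> \<bar>t - norm x\<bar> / t + norm (x - t *\<^sub>R u) / t" by simp
  also have "\<dots> < \<epsilon> / t + \<epsilon> / t"
    using \<open>\<bar>t - norm x\<bar> < \<epsilon>\<close> assms by (intro add_strict_mono divide_strict_right_mono) auto
  also have "\<dots> \<le> 4 * \<epsilon>"
  proof -
    have "\<epsilon> > 0" using assms(3) norm_ge_zero[of "x - t *\<^sub>R u"] by linarith
    then have "\<epsilon> * 1 \<le> \<epsilon> * (2 * t)" using assms by (intro mult_left_mono) auto
    then show ?thesis using assms by (simp add: field_simps)
  qed
  finally show ?thesis .
qed

lemma sphere_measure_cap_ge: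
  fixes u :: "'a::euclidean_space"
  assumes u: "norm u = 1" and \<delta>: "0 < \<delta>" "\<delta> \<le> 1"
  shows "ennreal (unit_ball_vol DIM('a) / 8 ^ DIM('a) * \<delta> ^ (DIM('a) - 1))
    \<le> emeasure sphere_measure (ball u \<delta> \<inter> sphere 0 1)"
proof -
  \<comment> \<open>The cone over the cap contains about \<open>1 / \<delta>\<close> disjoint balls of radius \<open>\<delta> / 8\<close> centred on the segment
    from \<open>u / 2\<close> to \<open>3 u / 4\<close>.\<close>
  let ?S = "{x \<in> ball 0 1 - {0}. x /\<^sub>R norm x \<in> ball u \<delta> \<inter> sphere 0 1}"
  define n where "n = nat \<lceil>1 / \<delta>\<rceil>"
  define t where "t j = 1/2 + real j * (\<delta> / 4)" for j
  define B where "B j = ball (t j *\<^sub>R u) (\<delta> / 8)" for j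
  have n: "1 / \<delta> \<le> real n" unfolding n_def using \<delta> by linarith
  have sub: "B j \<subseteq> ?S" if "j < n" for j
  proof
    fix x assume "x \<in> B j"
    then have x: "norm (x - t j *\<^sub>R u) < \<delta> / 8" by (simp add: B_def dist_norm norm_minus_commute)
    \<comment> \<open>This strict bound survives the rounding in n. It places the centres between
      heights 1/2 and 3/4, so balls of radius at most 1/8 avoid the origin and stay inside the unit
      ball.\<close>
    have "real j < 1 / \<delta>" using that unfolding n_def by linarith
    then have tj: "1/2 \<le> t j" "t j \<le> 3/4" using \<delta> by (auto simp: t_def field_simps)
    have "\<bar>norm x - t j\<bar> < \<delta> / 8"
      using norm_triangle_ineq3[of x "t j *\<^sub>R u"] x u tj by simp
    then have "norm x < 1" "0 < norm x" using tj \<delta> by linarith+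
    then have "norm x < 1" "x \<noteq> 0" by auto
    moreover have "norm (x /\<^sub>R norm x - u) < 4 * (\<delta> / 8)"
      using norm_normalize_diff_le[OF u tj(1) x \<open>x \<noteq> 0\<close>] .
    ultimately show "x \<in> ?S" using \<delta> by (auto simp: dist_norm norm_minus_commute)
  qed
  have disj: "disjoint_family_on B {..<n}"
    unfolding disjoint_family_on_def
  proof (intro ballI impI)
    fix i j :: nat assume "i \<noteq> j"
    then have "\<bar>real i - real j\<bar> \<ge> 1" by linarith
    moreover have "t i - t j = (real i - real j) * (\<delta> / 4)" by (simp add: t_def left_diff_distrib)
    ultimately have "\<bar>t i - t j\<bar> \<ge> \<delta> / 4"
      using \<delta> mult_right_mono[of 1 "\<bar>real i - real j\<bar>" "\<delta>/4"] by (simp only: abs_mult) simp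
    then have "dist (t i *\<^sub>R u) (t j *\<^sub>R u) \<ge> \<delta> / 8 + \<delta> / 8"
      using u by (simp add: dist_norm flip: scaleR_diff_left)
    then show "B i \<inter> B j = {}" unfolding B_def by (rule disjoint_ballI)
  qed
  \<comment> \<open>One ball has volume of order \<delta> ^ d; having at least 1 / \<delta> of them
    produces the exponent d - 1 of a cap.\<close>
  have "unit_ball_vol DIM('a) / 8 ^ DIM('a) * \<delta> ^ (DIM('a) - 1) =
      1 / \<delta> * (unit_ball_vol DIM('a) * (\<delta> / 8) ^ DIM('a))"
    using \<delta> by (simp add: power_divide power_eq_if[of \<delta> "DIM('a)"])
  also have "\<dots> \<le> real n * (unit_ball_vol DIM('a) * (\<delta> / 8) ^ DIM('a))"
    using n \<delta> by (intro mult_right_mono) auto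
  finally have "ennreal (unit_ball_vol DIM('a) / 8 ^ DIM('a) * \<delta> ^ (DIM('a) - 1)) \<le>
      of_nat n * ennreal (unit_ball_vol DIM('a) * (\<delta> / 8) ^ DIM('a))"
    using \<delta> by (subst ennreal_of_nat_eq_real_of_nat, subst ennreal_mult[symmetric]) (auto intro: ennreal_leI)
  also have "\<dots> = (\<Sum>j<n. emeasure lborel (B j))"
    using \<delta> by (simp add: B_def emeasure_ball)
  also have "\<dots> = emeasure lborel (\<Union>j<n. B j)"
    by (rule sum_emeasure[OF _ disj]) (auto simp: B_def)
  also have "\<dots> \<le> emeasure lborel ?S"
  proof (rule emeasure_mono)
    show "(\<Union>j<n. B j) \<subseteq> ?S" using sub by blast
    have "open ?S"
    proof -
      have "?S = {x \<in> ball 0 1 - {0}. x /\<^sub>R norm x \<in> ball u \<delta>}" by auto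
      also have "\<dots> = (ball 0 1 - {0}) \<inter> (\<lambda>x. x /\<^sub>R norm x) -` ball u \<delta>" by auto
      also have "open \<dots>"
        by (intro continuous_open_preimage continuous_intros open_Diff) auto
      finally show ?thesis .
    qed
    then show "?S \<in> sets lborel" by simp
  qed
  also have "\<dots> \<le> of_nat DIM('a) * emeasure lborel ?S"
  proof -
    have "(1::ennreal) \<le> of_nat DIM('a)"
      using of_nat_mono[of 1 "DIM('a)", where 'a = ennreal] DIM_positive[where 'a = 'a] by simp
    from mult_right_mono[OF this, of "emeasure lborel ?S"] show ?thesis by simp
  qed
  also have "\<dots> = emeasure sphere_measure (ball u \<delta> \<inter> sphere 0 1)"
    by (subst emeasure_sphere_measure) auto
  finally show ?thesis .
qed

section \<open>Lower bounds for the Fourier transform and its spherical average\<close>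

text \<open>Separation of the centres makes the caps disjoint, so their measures add, and the
  integrand is at least \<open>A ^ 2\<close> on the union.\<close>

lemma sphere_L2_sq_ge:
  fixes L :: "'a::euclidean_space set"
  assumes cap: "\<And>u::'a. norm u = 1 \<Longrightarrow> ennreal c \<le> emeasure sphere_measure (ball u \<delta> \<inter> sphere 0 1)"
    and "0 \<le> c" and L: "finite L" "L \<subseteq> sphere 0 1"
    and sep: "\<And>u v. u \<in> L \<Longrightarrow> v \<in> L \<Longrightarrow> u \<noteq> v \<Longrightarrow> 2 * \<delta> \<le> dist u v"
    and A: "0 \<le> A" "\<And>u \<omega>. u \<in> L \<Longrightarrow> \<omega> \<in> ball u \<delta> \<inter> sphere 0 1 \<Longrightarrow> A \<le> cmod (f \<omega>)"
  shows "ennreal (real (card L) * c * A\<^sup>2) \<le> sphere_L2_sq f"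
proof -
  let ?E = "\<Union>u\<in>L. ball u \<delta> \<inter> sphere 0 1"
  have sets: "ball u \<delta> \<inter> sphere 0 1 \<in> sets (sphere_measure :: 'a measure)" for u
    by (auto simp: sphere_measure_def sets_restrict_space_iff)
  have disj: "disjoint_family_on (\<lambda>u. ball u \<delta> \<inter> sphere 0 1) L"
    unfolding disjoint_family_on_def
  proof (intro ballI impI)
    fix u v assume "u \<in> L" "v \<in> L" "u \<noteq> v"
    then have "ball u \<delta> \<inter> ball v \<delta> = {}" using sep[of u v] by (intro disjoint_ballI) simp
    then show "ball u \<delta> \<inter> sphere 0 1 \<inter> (ball v \<delta> \<inter> sphere 0 1) = {}" by blast
  qed
  have "of_nat (card L) * ennreal c = (\<Sum>u\<in>L. ennreal c)" by simp
  also have "\<dots> \<le> (\<Sum>u\<in>L. emeasure sphere_measure (ball u \<delta> \<inter> sphere 0 1))"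
    using L by (intro sum_mono cap) auto
  also have "\<dots> = emeasure sphere_measure ?E"
    using disj L sets by (intro sum_emeasure) auto
  finally have E: "of_nat (card L) * ennreal c \<le> emeasure sphere_measure ?E" .
  have "ennreal (real (card L) * c * A\<^sup>2) = ennreal (A\<^sup>2) * (of_nat (card L) * ennreal c)"
    using \<open>0 \<le> c\<close> by (simp add: ennreal_mult ennreal_of_nat_eq_real_of_nat ac_simps)
  also have "\<dots> \<le> ennreal (A\<^sup>2) * emeasure sphere_measure ?E"
    by (intro mult_left_mono E) simp
  also have "\<dots> = (\<integral>\<^sup>+ \<omega>. ennreal (A\<^sup>2) * indicator ?E \<omega> \<partial>sphere_measure)"
    using sets L by (intro nn_integral_cmult_indicator[symmetric] sets.finite_UN) auto
  also have "\<dots> \<le> sphere_L2_sq f"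
    unfolding sphere_L2_sq_def
    using A by (intro nn_integral_mono) (auto simp: indicator_def intro!: ennreal_leI power_mono)
  finally show ?thesis .
qed

text \<open>No cancellation occurs: almost every phase factor has real part at least 1/2, so the
  real part of the integral is already at least half of the mass.\<close>

lemma cmod_fourier_measure_ge:
  fixes \<mu> :: "'a::euclidean_space measure"
  assumes "finite_measure \<mu>" and sets: "sets \<mu> = sets borel"
    and AE: "AE x in \<mu>. 1/2 \<le> cos (x \<bullet> \<xi>)"
  shows "(2 * pi) powr (- real DIM('a) / 2) * (measure \<mu> UNIV / 2) \<le> cmod (fourier_measure \<mu> \<xi>)"
proof -
  interpret finite_measure \<mu> by fact
  note [measurable_cong] = sets
  let ?e = "\<lambda>x. exp (- (\<i> * complex_of_real (x \<bullet> \<xi>)))"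
  have int: "integrable \<mu> ?e"
    by (rule integrable_const_bound[of _ 1]) (auto simp: measurable_cong_sets[OF sets refl])
  have "measure \<mu> UNIV / 2 = (LINT x|\<mu>. 1/2)"
    using sets_eq_imp_space_eq[OF sets] by simp
  also have "\<dots> \<le> (LINT x|\<mu>. Re (?e x))"
    using AE int by (intro integral_mono_AE integrable_Re) (auto simp: Re_exp elim: eventually_mono)
  also have "\<dots> = Re (LINT x|\<mu>. ?e x)" using int by (rule integral_Re)
  also have "\<dots> \<le> cmod (LINT x|\<mu>. ?e x)" by (rule complex_Re_le_cmod)
  finally show ?thesis
    unfolding fourier_measure_def by (simp add: norm_mult mult_left_mono)
qed

section \<open>Sums of Lebesgue measures on balls\<close>

text \<open>The density is a sum of indicators, not the indicator of the union, so that masses add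
  over \<open>G\<close> even where balls overlap.\<close>

definition ball_sum_measure :: "'a::euclidean_space set \<Rightarrow> real \<Rightarrow> 'a measure" where
  "ball_sum_measure G \<rho> = density lborel (\<lambda>x. \<Sum>g\<in>G. indicator (ball g \<rho>) x)"

lemma sets_ball_sum_measure [simp]: "sets (ball_sum_measure G \<rho>) = sets borel"
  by (simp add: ball_sum_measure_def)

lemma borel_measurable_sum_indicator_ball:
  "(\<lambda>x::'a::euclidean_space. \<Sum>g\<in>G. indicator (ball g \<rho>) x :: ennreal) \<in> borel_measurable borel"
  by (intro borel_measurable_sum borel_measurable_indicator) auto

lemma emeasure_ball_sum_measure:
  assumes "A \<in> sets borel"
  shows "emeasure (ball_sum_measure G \<rho>) A = (\<Sum>g\<in>G. emeasure lborel (ball g \<rho> \<inter> A))"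
proof -
  have "emeasure (ball_sum_measure G \<rho>) A =
      (\<integral>\<^sup>+ x. (\<Sum>g\<in>G. indicator (ball g \<rho> \<inter> A) x) \<partial>lborel)"
    using assms unfolding ball_sum_measure_def
    by (subst emeasure_density) (auto simp: sum_distrib_right indicator_inter_arith borel_measurable_sum_indicator_ball)
  also have "\<dots> = (\<Sum>g\<in>G. emeasure lborel (ball g \<rho> \<inter> A))"
    using assms by (subst nn_integral_sum) (simp_all add: borel_measurable_indicator)
  finally show ?thesis .
qed

lemma emeasure_ball_sum_measure_UNIV:
  fixes G :: "'a::euclidean_space set"
  assumes "0 \<le> \<rho>"
  shows "emeasure (ball_sum_measure G \<rho>) UNIV =
    ennreal (real (card G) * (unit_ball_vol DIM('a) * \<rho> ^ DIM('a)))"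
  using assms by (simp add: emeasure_ball_sum_measure emeasure_ball ennreal_mult ennreal_of_nat_eq_real_of_nat)

lemma AE_ball_sum_measure:
  assumes "\<And>g x. g \<in> G \<Longrightarrow> dist g x < \<rho> \<Longrightarrow> P x"
  shows "AE x in ball_sum_measure G \<rho>. P x"
  unfolding ball_sum_measure_def
proof (subst AE_density)
  show "AE x in lborel. 0 < (\<Sum>g\<in>G. indicator (ball g \<rho>) x :: ennreal) \<longrightarrow> P x"
  proof (rule AE_I2, rule impI)
    fix x assume "0 < (\<Sum>g\<in>G. indicator (ball g \<rho>) x :: ennreal)"
    then have "(\<Sum>g\<in>G. indicator (ball g \<rho>) x :: ennreal) \<noteq> 0" by simp
    then obtain g where "g \<in> G" "indicator (ball g \<rho>) x \<noteq> (0::ennreal)"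
      by (rule sum.not_neutral_contains_not_neutral)
    then show "P x" using assms[of g x] by (simp add: indicator_eq_0_iff)
  qed
qed (simp add: borel_measurable_sum_indicator_ball)

lemma measure_support_ball_sum_measure:
  assumes "\<And>g. g \<in> G \<Longrightarrow> norm g + \<rho> \<le> s"
  shows "measure_support (ball_sum_measure G \<rho>) \<subseteq> cball 0 s"
proof
  fix x assume x: "x \<in> measure_support (ball_sum_measure G \<rho>)"
  show "x \<in> cball 0 s"
  proof (rule ccontr)
    assume "x \<notin> cball 0 s"
    then have "0 < emeasure (ball_sum_measure G \<rho>) (- cball 0 s)"
      using x unfolding measure_support_def by (blast intro: open_Compl closed_cball)
    also have "\<dots> = (\<Sum>g\<in>G. emeasure lborel (ball g \<rho> \<inter> - cball 0 s))"
      by (rule emeasure_ball_sum_measure) auto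
    also have "\<dots> = 0"
    proof (intro sum.neutral ballI)
      fix g assume "g \<in> G"
      have "norm y \<le> s" if "dist g y < \<rho>" for y
        using assms[OF \<open>g \<in> G\<close>] that norm_triangle_sub[of y g] by (simp add: dist_norm norm_minus_commute)
      then have "ball g \<rho> \<inter> - cball 0 s = {}" by auto
      then show "emeasure lborel (ball g \<rho> \<inter> - cball 0 s) = 0" by simp
    qed
    finally show False by simp
  qed
qed

text \<open>Only balls whose centres are closer than r + \<rho> to x can meet
  \<open>ball x r\<close>, and each intersection lies in a ball of either radius, hence has at most
  the volume for the smaller one.\<close>

lemma emeasure_ball_sum_measure_ball_le:
  fixes G :: "'a::euclidean_space set"
  assumes "finite G" "0 < \<rho>" "0 < r"
  shows "emeasure (ball_sum_measure G \<rho>) (ball x r) \<le>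
    ennreal (real (card {g\<in>G. dist g x < r + \<rho>}) * (unit_ball_vol DIM('a) * (min r \<rho>) ^ DIM('a)))"
proof -
  let ?H = "{g\<in>G. dist g x < r + \<rho>}" and ?v = "ennreal (unit_ball_vol DIM('a) * (min r \<rho>) ^ DIM('a))"
  have "emeasure (ball_sum_measure G \<rho>) (ball x r) = (\<Sum>g\<in>G. emeasure lborel (ball g \<rho> \<inter> ball x r))"
    by (rule emeasure_ball_sum_measure) auto
  also have "\<dots> = (\<Sum>g\<in>?H. emeasure lborel (ball g \<rho> \<inter> ball x r))"
  proof (rule sum.mono_neutral_right)
    show "\<forall>g\<in>G - ?H. emeasure lborel (ball g \<rho> \<inter> ball x r) = 0"
      using disjoint_ballI[of \<rho> r _ x] by (auto simp: not_less add.commute)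
  qed (use assms in auto)
  also have "\<dots> \<le> (\<Sum>g\<in>?H. ?v)"
  proof (rule sum_mono)
    fix g
    show "emeasure lborel (ball g \<rho> \<inter> ball x r) \<le> ?v"
      using emeasure_mono[of "ball g \<rho> \<inter> ball x r" "ball g \<rho>" lborel]
        emeasure_mono[of "ball g \<rho> \<inter> ball x r" "ball x r" lborel] assms
      by (simp add: emeasure_ball min_def)
  qed
  also have "\<dots> = ennreal (real (card ?H) * (unit_ball_vol DIM('a) * (min r \<rho>) ^ DIM('a)))"
    using assms by (simp add: ennreal_mult ennreal_of_nat_eq_real_of_nat)
  finally show ?thesis .
qed

section \<open>Lattices and the dimension constant\<close>

text \<open>The argument is the reciprocal of the spacing. Thus \<open>lattice_grid 1\<close> is the
  integer lattice, and 2 pi h times it is the dual of \<open>lattice_grid h\<close>.\<close>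

definition lattice_grid :: "real \<Rightarrow> 'a::euclidean_space set" where
  "lattice_grid h = {x. \<forall>b\<in>Basis. x \<bullet> b \<in> range (\<lambda>k::int. real_of_int k / h)}"

lemma lattice_gridE:
  assumes "x \<in> lattice_grid h" "b \<in> Basis"
  obtains k :: int where "x \<bullet> b = k / h"
proof -
  have "x \<bullet> b \<in> range (\<lambda>k::int. k / h)" using assms by (simp add: lattice_grid_def)
  then show thesis by (rule imageE) (rule that)
qed

text \<open>The ball lies in a cube of side 2 r. After scaling by h, each coordinate is an integer
  in an open interval of length 2 r h, which leaves at most 2 r h + 1 choices.\<close>

lemma card_lattice_grid_ball_le:
  fixes G :: "'a::euclidean_space set"
  assumes G: "G \<subseteq> lattice_grid h" and "0 < h" "0 \<le> r"
  shows "real (card {g\<in>G. dist g x < r}) \<le> (2 * r * h + 1) ^ DIM('a)"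
proof -
  define I where "I b = {k::int. (x \<bullet> b - r) * h < k \<and> k < (x \<bullet> b + r) * h}" for b
  define A where "A b = (\<lambda>k::int. real_of_int k / h) ` I b" for b
  have I: "finite (I b)" "real (card (I b)) \<le> 2 * r * h + 1" for b
  proof -
    have "I b \<subseteq> {\<lfloor>(x \<bullet> b - r) * h\<rfloor>..\<lceil>(x \<bullet> b + r) * h\<rceil>}"
      unfolding I_def by (auto; linarith)
    then show "finite (I b)" by (rule finite_subset) simp
    have "(x \<bullet> b - r) * h \<le> (x \<bullet> b + r) * h" using assms by (intro mult_right_mono) auto
    from card_int_interval_le[OF this] show "real (card (I b)) \<le> 2 * r * h + 1"
      by (simp add: I_def algebra_simps)
  qed
  have finA: "finite (A b)" for b using I by (simp add: A_def)
  have "{g\<in>G. dist g x < r} \<subseteq> {g. \<forall>b\<in>Basis. g \<bullet> b \<in> A b}"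
  proof (rule subsetI, rule CollectI, rule ballI)
    fix g b :: 'a assume g: "g \<in> {g\<in>G. dist g x < r}" and b: "b \<in> Basis"
    then obtain k :: int where k: "g \<bullet> b = real_of_int k / h"
      using lattice_gridE[of g h b] G by blast
    have "\<bar>g \<bullet> b - x \<bullet> b\<bar> < r"
      using Basis_le_norm[OF b, of "g - x"] g by (simp add: dist_norm inner_diff_left)
    then have "(x \<bullet> b - r) * h < k" "k < (x \<bullet> b + r) * h"
      using \<open>0 < h\<close> unfolding k by (auto simp: abs_less_iff field_simps)
    then show "g \<bullet> b \<in> A b" unfolding A_def I_def k by blast
  qed
  then have "card {g\<in>G. dist g x < r} \<le> card {g. \<forall>b\<in>Basis. (g::'a) \<bullet> b \<in> A b}"
    using finA by (intro card_mono finite_coordinate_box)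
  also have "\<dots> = (\<Prod>b\<in>(Basis::'a set). card (A b))"
    using finA by (rule card_coordinate_box)
  finally have "real (card {g\<in>G. dist g x < r}) \<le> (\<Prod>b\<in>(Basis::'a set). real (card (A b)))"
    by (metis of_nat_le_iff of_nat_prod)
  also have "\<dots> \<le> (\<Prod>b\<in>(Basis::'a set). 2 * r * h + 1)"
  proof (intro prod_mono conjI)
    fix b :: 'a
    show "real (card (A b)) \<le> 2 * r * h + 1"
      using card_image_le[OF I(1), of "\<lambda>k. real_of_int k / h" b] I(2)[of b] unfolding A_def by linarith
  qed simp
  finally show ?thesis by simp
qed

text \<open>Here c stands for the number of balls that meet a ball of radius r. Three ranges of r
  occur. Below the spacing 1 / h at most \<open>5 ^ D\<close> balls are met, and the smallness of r
  or \<rho> yields the term \<rho> powr (- \<alpha>). Between 1 / h and 1 the count is at most (5 r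
  h) ^ D, and r ^ D is at most r powr \<alpha>. Above 1 the total number of balls suffices.\<close>

lemma ball_sum_measure_growth:
  fixes \<alpha> \<rho> h r V c :: real and D :: nat
  assumes \<alpha>: "0 < \<alpha>" "\<alpha> \<le> D" and \<rho>: "0 < \<rho>" "\<rho> * h \<le> 1" and "0 < h" "0 < r" "0 \<le> V" "0 \<le> c"
    and c1: "c \<le> (2 * (r + \<rho>) * h + 1) ^ D" and c2: "c \<le> h ^ D"
  shows "c * (V * (min r \<rho>) ^ D) \<le> 5 ^ D * (V * \<rho> ^ D) * (\<rho> powr (- \<alpha>) + h ^ D) * r powr \<alpha>"
proof -
  have "c * (min r \<rho>) ^ D \<le> 5 ^ D * \<rho> ^ D * (\<rho> powr (- \<alpha>) + h ^ D) * r powr \<alpha>"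
  proof (cases "r * h \<le> 1")
    case True
    then have "c \<le> 5 ^ D"
      using assms by (intro order.trans[OF c1] power_mono) (auto simp: algebra_simps)
    moreover have "(min r \<rho>) ^ D \<le> \<rho> ^ D * \<rho> powr (- \<alpha>) * r powr \<alpha>"
    proof -
      let ?m = "min r \<rho>"
      have m: "0 < ?m" "?m \<le> r" "?m \<le> \<rho>" using assms by auto
      \<comment> \<open>The exponent is split as (D - \<alpha>) + \<alpha>, both parts nonnegative;
        the first is charged to \<rho> and the second to r.\<close>
      have "?m ^ D = ?m powr (D - \<alpha>) * ?m powr \<alpha>"
        using m by (simp add: powr_realpow flip: powr_add)
      also have "\<dots> \<le> \<rho> powr (D - \<alpha>) * r powr \<alpha>"
        using m \<alpha> by (intro mult_mono powr_mono2) auto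
      also have "\<rho> powr (D - \<alpha>) = \<rho> ^ D * \<rho> powr (- \<alpha>)"
        using \<rho> by (simp add: powr_realpow powr_diff powr_minus divide_inverse)
      finally show ?thesis .
    qed
    ultimately have "c * (min r \<rho>) ^ D \<le> 5 ^ D * (\<rho> ^ D * \<rho> powr (- \<alpha>) * r powr \<alpha>)"
      using assms by (intro mult_mono) auto
    also have "\<dots> \<le> 5 ^ D * \<rho> ^ D * (\<rho> powr (- \<alpha>) + h ^ D) * r powr \<alpha>"
      using assms by (simp add: algebra_simps)
    finally show ?thesis .
  next
    case False
    have "c \<le> 5 ^ D * h ^ D * r powr \<alpha>"
    proof (cases "r \<le> 1")
      case True
      have "2 * (r + \<rho>) * h + 1 \<le> 5 * (r * h)" using False \<rho> by (simp add: algebra_simps)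
      then have "c \<le> (5 * (r * h)) ^ D"
        using assms by (intro order.trans[OF c1] power_mono) auto
      also have "\<dots> = 5 ^ D * h ^ D * r powr D"
        using assms by (simp add: power_mult_distrib powr_realpow)
      also have "\<dots> \<le> 5 ^ D * h ^ D * r powr \<alpha>"
        using True assms by (intro mult_left_mono powr_mono') auto
      finally show ?thesis .
    next
      case False
      have "c \<le> 1 * h ^ D * 1" using c2 by simp
      also have "\<dots> \<le> 5 ^ D * h ^ D * r powr \<alpha>"
        using False assms by (intro mult_mono ge_one_powr_ge_zero) auto
      finally show ?thesis .
    qed
    then have "c * (min r \<rho>) ^ D \<le> (5 ^ D * h ^ D * r powr \<alpha>) * \<rho> ^ D"
      using assms by (intro mult_mono power_mono) auto
    also have "\<dots> \<le> 5 ^ D * \<rho> ^ D * (\<rho> powr (- \<alpha>) + h ^ D) * r powr \<alpha>"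
      using assms by (simp add: algebra_simps)
    finally show ?thesis .
  qed
  from mult_left_mono[OF this \<open>0 \<le> V\<close>] show ?thesis by (simp add: ac_simps)
qed

text \<open>The first term reflects radii below the spacing, the second radii above it. They balance
  when \<open>h ^ d\<close> is of order \<rho> powr (- \<alpha>).\<close>

lemma c_dim_ball_sum_measure_le:
  fixes G :: "'a::euclidean_space set" and \<alpha> \<rho> h :: real
  assumes G: "finite G" "G \<subseteq> lattice_grid h" "real (card G) \<le> h ^ DIM('a)"
    and \<alpha>: "0 < \<alpha>" "\<alpha> \<le> DIM('a)" and \<rho>: "0 < \<rho>" "\<rho> * h \<le> 1" and "0 < h"
  shows "c_dim \<alpha> (ball_sum_measure G \<rho>) \<le>
    ennreal (5 ^ DIM('a) * (unit_ball_vol DIM('a) * \<rho> ^ DIM('a)) * (\<rho> powr (- \<alpha>) + h ^ DIM('a)))"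
    (is "_ \<le> ennreal ?B")
  unfolding c_dim_def
proof (intro SUP_least)
  fix x :: 'a and r :: real assume "r \<in> {0<..}"
  then have r: "0 < r" by simp
  let ?c = "real (card {g\<in>G. dist g x < r + \<rho>})"
  have "?c \<le> card G" using G by (intro of_nat_mono card_mono) auto
  then have c2: "?c \<le> h ^ DIM('a)" using G by linarith
  have "emeasure (ball_sum_measure G \<rho>) (ball x r) \<le>
      ennreal (?c * (unit_ball_vol DIM('a) * (min r \<rho>) ^ DIM('a)))"
    using G \<rho> r by (intro emeasure_ball_sum_measure_ball_le)
  also have "\<dots> \<le> ennreal (?B * r powr \<alpha>)"
    using \<alpha> \<rho> \<open>0 < h\<close> r c2 card_lattice_grid_ball_le[OF G(2) \<open>0 < h\<close>, of "r + \<rho>" x]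
    by (intro ennreal_leI ball_sum_measure_growth) auto
  finally have "emeasure (ball_sum_measure G \<rho>) (ball x r) \<le> ennreal ?B * ennreal (r powr \<alpha>)"
    using \<rho> \<open>0 < h\<close> by (subst ennreal_mult[symmetric]) auto
  then have "emeasure (ball_sum_measure G \<rho>) (ball x r) / ennreal (r powr \<alpha>) \<le>
      ennreal ?B * ennreal (r powr \<alpha>) / ennreal (r powr \<alpha>)"
    by (rule divide_right_mono_ennreal)
  also have "\<dots> = ennreal ?B"
    using r by (intro ennreal_mult_divide_eq) auto
  finally show "emeasure (ball_sum_measure G \<rho>) (ball x r) / ennreal (r powr \<alpha>) \<le> ennreal ?B" .
qed

section \<open>Many integer points on one sphere\<close>

text \<open>Pigeonhole on the squared norm over a cube. Coordinates above K and at most 2 K make the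
  radius comparable to K, and the integrality of the squared norm limits the number of values to 4 d
  K ^ 2.\<close>

lemma lattice_points_on_sphere:
  fixes K :: nat
  assumes "K \<ge> 1"
  obtains m :: nat and L :: "'a::euclidean_space set"
  where "finite L" "L \<subseteq> lattice_grid 1" "\<And>l. l \<in> L \<Longrightarrow> (norm l)\<^sup>2 = real m"
    "K\<^sup>2 \<le> m" "m \<le> 4 * DIM('a) * K\<^sup>2" "K ^ DIM('a) \<le> 4 * DIM('a) * K\<^sup>2 * card L"
proof -
  define Z where "Z = {l::'a. \<forall>b\<in>Basis. l \<bullet> b \<in> real ` {K<..2 * K}}"
  \<comment> \<open>The floor only serves to obtain a natural number; on \<open>Z\<close> the
    squared norm is an integer and nothing is lost.\<close>
  define f where "f l = nat \<lfloor>(norm l)\<^sup>2\<rfloor>" for l :: 'a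
  have finZ: "finite Z" unfolding Z_def by (rule finite_coordinate_box) simp
  have cardZ: "card Z = K ^ DIM('a)"
    unfolding Z_def by (subst card_coordinate_box) (auto simp: card_image inj_on_def)
  let ?B = "{1..4 * DIM('a) * K\<^sup>2}"
  have Z: "(norm l)\<^sup>2 = real (f l)" "K\<^sup>2 \<le> f l" "f l \<le> 4 * DIM('a) * K\<^sup>2" if "l \<in> Z" for l
  proof -
    have "\<forall>b\<in>Basis. \<exists>j. l \<bullet> b = real j \<and> K < j \<and> j \<le> 2 * K" using that by (auto simp: Z_def)
    then obtain j where j: "\<And>b. b \<in> Basis \<Longrightarrow> l \<bullet> b = real (j b) \<and> K < j b \<and> j b \<le> 2 * K" by metis
    have "(norm l)\<^sup>2 = (\<Sum>b\<in>Basis. (l \<bullet> b)\<^sup>2)"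
      unfolding power2_norm_eq_inner by (subst euclidean_inner) (simp only: power2_eq_square)
    also have "\<dots> = (\<Sum>b\<in>Basis. real ((j b)\<^sup>2))"
      by (intro sum.cong refl) (simp only: j of_nat_power)
    finally have eq: "(norm l)\<^sup>2 = real (\<Sum>b\<in>(Basis::'a set). (j b)\<^sup>2)"
      by (simp only: of_nat_sum)
    then have f: "f l = (\<Sum>b\<in>(Basis::'a set). (j b)\<^sup>2)"
      by (simp only: f_def floor_of_nat nat_int)
    show "(norm l)\<^sup>2 = real (f l)" by (simp only: eq f)
    obtain b :: 'a where b: "b \<in> Basis" using nonempty_Basis by blast
    have "K\<^sup>2 \<le> (j b)\<^sup>2" using j[OF b] by (intro power_mono) auto
    also have "\<dots> \<le> f l" unfolding f using b by (intro member_le_sum) auto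
    finally show "K\<^sup>2 \<le> f l" .
    have "f l \<le> (\<Sum>b\<in>(Basis::'a set). (2 * K)\<^sup>2)"
      unfolding f by (intro sum_mono power_mono) (simp_all add: j)
    then show "f l \<le> 4 * DIM('a) * K\<^sup>2" by (simp add: power_mult_distrib)
  qed
  have "1 \<le> K\<^sup>2" using assms by simp
  then have "f l \<in> ?B" if "l \<in> Z" for l using Z(2,3)[OF that] by (simp del: One_nat_def)
  moreover have "?B \<noteq> {}" using \<open>1 \<le> K\<^sup>2\<close> DIM_positive[where 'a = 'a] by (simp add: Suc_le_eq)
  ultimately have "f \<in> Z \<rightarrow> ?B" "?B \<noteq> {}" by blast+
  then obtain m where m: "m \<in> ?B" "card Z \<le> card (f -` {m} \<inter> Z) * card ?B"
    using pigeonhole_card[of f Z ?B] finZ by auto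
  let ?L = "f -` {m} \<inter> Z"
  \<comment> \<open>The fibre must be nonempty because K ^ 2 \<le> m is read off from one of its
    points; membership in \<open>?B\<close> only gives 1 \<le> m.\<close>
  have "0 < card Z" using assms cardZ by simp
  then have "?L \<noteq> {}" using m(2) by auto
  then obtain l where "l \<in> ?L" by blast
  show thesis
  proof (rule that[of ?L m])
    show "finite ?L" using finZ by simp
    have "x \<in> lattice_grid 1" if "x \<in> Z" for x
      unfolding lattice_grid_def
    proof (rule CollectI, rule ballI)
      fix b :: 'a assume "b \<in> Basis"
      with that have "x \<bullet> b \<in> real ` {K<..2 * K}" by (simp add: Z_def)
      then obtain j where j: "x \<bullet> b = real j" by (rule imageE)
      show "x \<bullet> b \<in> range (\<lambda>k::int. real_of_int k / 1)"
        unfolding j by (rule range_eqI[of _ _ "int j"]) simp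
    qed
    then show "?L \<subseteq> lattice_grid 1" by blast
    show "(norm l)\<^sup>2 = real m" if "l \<in> ?L" for l using that Z(1) by auto
    show "K\<^sup>2 \<le> m" "m \<le> 4 * DIM('a) * K\<^sup>2" using \<open>l \<in> ?L\<close> Z(2,3) by auto
    show "K ^ DIM('a) \<le> 4 * DIM('a) * K\<^sup>2 * card ?L" using m(2) cardZ by (simp add: mult.commute)
  qed
qed

lemma lattice_grid_1_separated:
  fixes l l' :: "'a::euclidean_space"
  assumes "l \<in> lattice_grid 1" "l' \<in> lattice_grid 1" "l \<noteq> l'"
  shows "1 \<le> dist l l'"
proof -
  obtain b where b: "b \<in> Basis" "l \<bullet> b \<noteq> l' \<bullet> b" using assms(3) euclidean_eq_iff by blast
  obtain k k' :: int where k: "l \<bullet> b = k" "l' \<bullet> b = k'"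
    using lattice_gridE[OF assms(1) b(1)] lattice_gridE[OF assms(2) b(1)] by (metis div_by_1)
  have "1 \<le> \<bar>k - k'\<bar>" using b k by auto
  then have "1 \<le> \<bar>(l - l') \<bullet> b\<bar>" unfolding inner_diff_left k by linarith
  also have "\<dots> \<le> dist l l'" unfolding dist_norm using b by (intro Basis_le_norm)
  finally show ?thesis .
qed

section \<open>Phases near dual lattice points\<close>

text \<open>With \<eta> = 2 pi h l, the phase splits into (x - g) \<bullet> \<xi>, g \<bullet>
  (\<xi> - \<eta>) and g \<bullet> \<eta>. The last is a multiple of 2 pi; the other two are at most
  1/2 each by Cauchy-Schwarz, and their sum stays below pi / 3, where the cosine is 1/2.\<close>

lemma cos_inner_near_lattice_ge:
  fixes g x l \<xi> :: "'a::euclidean_space"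
  assumes g: "g \<in> lattice_grid h" "norm g \<le> 1" and "h > 0" and l: "l \<in> lattice_grid 1"
    and x: "dist g x * norm \<xi> \<le> 1/2" and \<xi>: "norm (\<xi> - (2 * pi * h) *\<^sub>R l) \<le> 1/2"
  shows "1/2 \<le> cos (x \<bullet> \<xi>)"
proof -
  let ?\<eta> = "(2 * pi * h) *\<^sub>R l"
  have "h * (g \<bullet> l) \<in> \<int>"
  proof -
    have "h * (g \<bullet> l) = (\<Sum>b\<in>Basis. (h * (g \<bullet> b)) * (l \<bullet> b))"
      by (simp add: euclidean_inner[of g l] sum_distrib_left mult.assoc)
    also have "\<dots> \<in> \<int>"
    proof (rule Ints_sum)
      fix b :: 'a assume "b \<in> Basis"
      then obtain k k' :: int where "g \<bullet> b = k / h" "l \<bullet> b = k' / 1"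
        using lattice_gridE[OF g(1)] lattice_gridE[OF l] by metis
      then show "h * (g \<bullet> b) * (l \<bullet> b) \<in> \<int>" using \<open>h > 0\<close> by simp
    qed
    finally show ?thesis .
  qed
  then obtain n :: int where n: "h * (g \<bullet> l) = n" by (elim Ints_cases)
  define s where "s = (x - g) \<bullet> \<xi> + g \<bullet> (\<xi> - ?\<eta>)"
  have "g \<bullet> ?\<eta> = 2 * pi * (h * (g \<bullet> l))" by (simp add: ac_simps)
  then have "x \<bullet> \<xi> = s + 2 * pi * n"
    unfolding s_def n by (simp add: inner_diff_left inner_diff_right)
  then have "cos (x \<bullet> \<xi>) = cos s"
    by (simp add: cos_add cos_int_2pin sin_int_2pin)
  moreover have "\<bar>s\<bar> \<le> 1"
  proof -
    have "\<bar>(x - g) \<bullet> \<xi>\<bar> \<le> 1/2"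
      using Cauchy_Schwarz_ineq2[of "x - g" \<xi>] x by (simp add: dist_norm norm_minus_commute)
    moreover have "\<bar>g \<bullet> (\<xi> - ?\<eta>)\<bar> \<le> 1 * (1/2)"
      using Cauchy_Schwarz_ineq2[of g "\<xi> - ?\<eta>"] mult_mono[OF g(2) \<xi>] by auto
    ultimately show ?thesis unfolding s_def by linarith
  qed
  moreover have "cos (pi/3) \<le> cos \<bar>s\<bar>"
    using \<open>\<bar>s\<bar> \<le> 1\<close> pi_gt3 by (intro cos_monotone_0_pi_le) auto
  ultimately show ?thesis by (simp add: cos_60)
qed

section \<open>The measure at a single scale\<close>

text \<open>The radius R is obtained instead of prescribed, because it depends on which sphere the
  pigeonhole argument selects; it is only known to be comparable to N K. The number n counts the
  caps.\<close>

lemma lattice_ball_measure: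
  fixes \<alpha> :: real and N K :: nat
  defines "D \<equiv> DIM('a::euclidean_space)"
  assumes \<alpha>: "0 < \<alpha>" "\<alpha> \<le> D" and "1 \<le> N" "1 \<le> K" and NK: "real N ^ D \<le> (real N * real K) powr \<alpha>"
  obtains R M :: real and n :: nat and \<mu> :: "'a::euclidean_space measure"
  where "alpha_dimensional \<alpha> \<mu>" "1 < R" "real N * real K \<le> R" "R \<le> 8 * pi * real D ^ 2 * (real N * real K)"
    "M = real N ^ D * (unit_ball_vol D * (1 / (2 * R)) ^ D)" "emeasure \<mu> UNIV = ennreal M"
    "c_dim \<alpha> \<mu> \<le> ennreal (5 ^ D * (unit_ball_vol D * (1 / (2 * R)) ^ D) * ((2 ^ D + (2 * real D) ^ D) * R powr \<alpha>))"
    "ennreal (real n * (unit_ball_vol D / 8 ^ D * (1 / (2 * R)) ^ (D - 1)) * ((2 * pi) powr (- real D / 2) * (M / 2))\<^sup>2)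
      \<le> sphere_L2_sq (\<lambda>\<omega>. fourier_measure \<mu> (R *\<^sub>R \<omega>))"
    "K ^ D \<le> 4 * D * K\<^sup>2 * n"
proof -
  have D: "1 \<le> D" using DIM_positive[where 'a = 'a] unfolding D_def by linarith
  obtain m :: nat and L :: "'a set" where L: "finite L" "L \<subseteq> lattice_grid 1" "\<And>l. l \<in> L \<Longrightarrow> (norm l)\<^sup>2 = real m"
    "K\<^sup>2 \<le> m" "m \<le> 4 * D * K\<^sup>2" "K ^ D \<le> 4 * D * K\<^sup>2 * card L"
    by (rule lattice_points_on_sphere[OF \<open>1 \<le> K\<close>, where 'a = 'a, folded D_def]) blast
  \<comment> \<open>The factor 2 D makes N / h, summed over the D coordinates, equal to 1/2. All
    centres then have norm at most 1/2, which leaves room for the balls.\<close>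
  define h where "h = 2 * real D * real N"
  define s where "s = sqrt (real m)"
  \<comment> \<open>Dual lattice points are 2 pi h times integer points, so those with norm l = s
    land exactly on the sphere of radius R. The radius \<rho> below serves balls and caps alike and
    is fixed by R * \<rho> = 1/2, the phase error allowed for each.\<close>
  define R where "R = 2 * pi * h * s"
  define \<rho> where "\<rho> = 1 / (2 * R)"
  define G where "G = {g::'a. \<forall>b\<in>Basis. g \<bullet> b \<in> (\<lambda>j::nat. real j / h) ` {..<N}}"
  define M where "M = real N ^ D * (unit_ball_vol D * \<rho> ^ D)"
  have "1 * 1 \<le> real D * real N" using D \<open>1 \<le> N\<close> by (intro mult_mono) auto
  then have h: "2 \<le> h" by (simp add: h_def)
  have "(real K)\<^sup>2 \<le> real m" using L(4) by (metis of_nat_le_iff of_nat_power)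
  then have sK: "real K \<le> s" unfolding s_def by (rule real_le_rsqrt)
  then have s: "1 \<le> s" using \<open>1 \<le> K\<close> by linarith
  have "s \<le> 2 * real D * real K"
  proof -
    have "real m \<le> real (4 * D * K\<^sup>2)" using L(5) by (rule of_nat_mono)
    also have "\<dots> \<le> real (4 * D ^ 2 * K\<^sup>2)" using D by (intro of_nat_mono) (simp add: power2_eq_square)
    also have "\<dots> = (2 * real D * real K)\<^sup>2" by (simp add: power_mult_distrib)
    finally show ?thesis unfolding s_def by (intro real_le_lsqrt) auto
  qed
  then have "R \<le> 2 * pi * h * (2 * real D * real K)" using h unfolding R_def by (intro mult_left_mono) auto
  then have R_le: "R \<le> 8 * pi * real D ^ 2 * (real N * real K)" by (simp add: h_def power2_eq_square ac_simps)
  have pi1: "1 \<le> pi" using pi_gt3 by linarith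
  have hs_R: "h * s \<le> R"
  proof -
    have "1 * (h * s) \<le> (2 * pi) * (h * s)" using pi1 h s by (intro mult_right_mono) auto
    then show ?thesis by (simp add: R_def ac_simps)
  qed
  moreover have "h * 1 \<le> h * s" "2 * s \<le> h * s" using h s by (auto intro!: mult_left_mono mult_right_mono)
  ultimately have R: "h \<le> R" "s \<le> R" "2 \<le> R" using h s by linarith+
  have "real N * real K \<le> h * s"
  proof (rule mult_mono)
    have "1 * real N \<le> (2 * real D) * real N" using D by (intro mult_right_mono) auto
    then show "real N \<le> h" by (simp add: h_def)
  qed (use sK s h in auto)
  then have NK_R: "real N * real K \<le> R" using hs_R by linarith
  have \<rho>: "0 < \<rho>" "\<rho> \<le> 1/4" "\<rho> * h \<le> 1" "R * \<rho> = 1/2"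
    using R h unfolding \<rho>_def by (auto simp: field_simps)
  have cardG: "card G = N ^ D"
    unfolding G_def D_def using h by (subst card_coordinate_box) (auto simp: card_image inj_on_def)
  have finG: "finite G" unfolding G_def by (rule finite_coordinate_box) simp
  have G_grid: "G \<subseteq> lattice_grid h"
  proof
    fix g assume "g \<in> G"
    show "g \<in> lattice_grid h"
      unfolding lattice_grid_def
    proof (rule CollectI, rule ballI)
      fix b :: 'a assume "b \<in> Basis"
      with \<open>g \<in> G\<close> have "g \<bullet> b \<in> (\<lambda>j::nat. real j / h) ` {..<N}" by (simp add: G_def)
      then obtain j where j: "g \<bullet> b = real j / h" by (rule imageE)
      show "g \<bullet> b \<in> range (\<lambda>k::int. k / h)"
        unfolding j by (rule range_eqI[of _ _ "int j"]) simp
    qed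
  qed
  have norm_G: "norm g \<le> 1/2" if "g \<in> G" for g
  proof -
    have "norm g \<le> (\<Sum>b\<in>Basis. \<bar>g \<bullet> b\<bar>)" by (rule norm_le_l1)
    also have "\<dots> \<le> (\<Sum>b\<in>(Basis::'a set). N / h)"
    proof (rule sum_mono)
      fix b :: 'a assume "b \<in> Basis"
      with that have "g \<bullet> b \<in> (\<lambda>j::nat. real j / h) ` {..<N}" by (simp add: G_def)
      then obtain j where "g \<bullet> b = real j / h" "j \<in> {..<N}" by (rule imageE)
      then show "\<bar>g \<bullet> b\<bar> \<le> N / h" using h by (simp add: divide_right_mono)
    qed
    also have "\<dots> = 1/2" using D \<open>1 \<le> N\<close> unfolding h_def D_def by simp
    finally show ?thesis .
  qed
  let ?\<mu> = "ball_sum_measure G \<rho>"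
  have M: "0 \<le> M" "emeasure ?\<mu> UNIV = ennreal M"
    using \<rho> unfolding M_def by (auto simp: emeasure_ball_sum_measure_UNIV cardG D_def)
  have "c_dim \<alpha> ?\<mu> \<le> ennreal (5 ^ D * (unit_ball_vol D * \<rho> ^ D) * (\<rho> powr (- \<alpha>) + h ^ D))"
    unfolding D_def
  proof (rule c_dim_ball_sum_measure_le[OF finG G_grid])
    have "real N \<le> h" using D by (simp add: h_def mult_le_cancel_right1)
    then show "real (card G) \<le> h ^ DIM('a)" unfolding cardG D_def of_nat_power by (intro power_mono) auto
  qed (use \<alpha> \<rho> h in \<open>auto simp: D_def\<close>)
  \<comment> \<open>Both terms are of order \<open>R powr \<alpha>\<close>: the first because \<rho>
    = 1 / (2 R), the second because N ^ D is at most (N K) powr \<alpha> by assumption and N K \<le>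
    R.\<close>
  also have "\<dots> \<le> ennreal (5 ^ D * (unit_ball_vol D * \<rho> ^ D) * ((2 ^ D + (2 * real D) ^ D) * R powr \<alpha>))"
  proof (intro ennreal_leI mult_left_mono)
    have "\<rho> powr (- \<alpha>) = 2 powr \<alpha> * R powr \<alpha>"
      using R unfolding \<rho>_def by (simp add: powr_minus powr_divide powr_mult)
    also have "\<dots> \<le> 2 ^ D * R powr \<alpha>"
      using \<alpha> powr_mono[of \<alpha> "real D" 2] by (intro mult_right_mono) (auto simp: powr_realpow)
    finally have 1: "\<rho> powr (- \<alpha>) \<le> 2 ^ D * R powr \<alpha>" .
    have "h ^ D = (2 * real D) ^ D * real N ^ D" by (simp add: h_def power_mult_distrib)
    also have "\<dots> \<le> (2 * real D) ^ D * R powr \<alpha>"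
      using order.trans[OF NK powr_mono2[OF _ _ NK_R]] \<alpha> by (intro mult_left_mono) auto
    finally show "\<rho> powr (- \<alpha>) + h ^ D \<le> (2 ^ D + (2 * real D) ^ D) * R powr \<alpha>"
      using 1 by (simp add: algebra_simps)
  qed (use \<rho> in auto)
  finally have c_dim: "c_dim \<alpha> ?\<mu> \<le>
    ennreal (5 ^ D * (unit_ball_vol D * \<rho> ^ D) * ((2 ^ D + (2 * real D) ^ D) * R powr \<alpha>))" .
  have "measure_support ?\<mu> \<subseteq> cball 0 (3/4)"
  proof (rule measure_support_ball_sum_measure)
    fix g assume "g \<in> G"
    then show "norm g + \<rho> \<le> 3/4" using norm_G[of g] \<rho>(2) by linarith
  qed
  also have "\<dots> \<subseteq> ball 0 1" by auto
  finally have "alpha_dimensional \<alpha> ?\<mu>"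
    unfolding alpha_dimensional_def using le_less_trans[OF c_dim] by auto
  define U where "U = (\<lambda>l. l /\<^sub>R s) ` L"
  have cardU: "card U = card L" unfolding U_def using s by (intro card_image) (auto simp: inj_on_def)
  let ?A = "(2 * pi) powr (- real D / 2) * (M / 2)"
  have "ennreal (real (card U) * (unit_ball_vol D / 8 ^ D * \<rho> ^ (D - 1)) * ?A\<^sup>2)
      \<le> sphere_L2_sq (\<lambda>\<omega>. fourier_measure ?\<mu> (R *\<^sub>R \<omega>))"
  proof (rule sphere_L2_sq_ge)
    show "ennreal (unit_ball_vol D / 8 ^ D * \<rho> ^ (D - 1)) \<le> emeasure sphere_measure (ball u \<rho> \<inter> sphere 0 1)"
      if "norm u = 1" for u :: 'a
      using sphere_measure_cap_ge[OF that] \<rho> unfolding D_def by simp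
    show "0 \<le> unit_ball_vol D / 8 ^ D * \<rho> ^ (D - 1)" using \<rho> by simp
    show "finite U" using L unfolding U_def by simp
    show "0 \<le> ?A" using M by simp
    show "U \<subseteq> sphere 0 1"
    proof
      fix u assume "u \<in> U"
      then obtain l where l: "l \<in> L" "u = l /\<^sub>R s" unfolding U_def by blast
      have "norm l = s" unfolding s_def using L(3)[OF l(1)] by (metis norm_ge_zero real_sqrt_unique)
      then show "u \<in> sphere 0 1" using s l by simp
    qed
    \<comment> \<open>Distinct integer points are at distance at least 1, so the directions are 1 /
      s apart, and s \<le> R turns this into 2 \<rho>.\<close>
    show "2 * \<rho> \<le> dist u v" if "u \<in> U" "v \<in> U" "u \<noteq> v" for u v
    proof -
      obtain l l' where l: "l \<in> L" "l' \<in> L" "u = l /\<^sub>R s" "v = l' /\<^sub>R s" using \<open>u \<in> U\<close> \<open>v \<in> U\<close> unfolding U_def by blast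
      have "1 \<le> dist l l'" using l L(2) \<open>u \<noteq> v\<close> by (intro lattice_grid_1_separated) auto
      moreover have "dist u v = dist l l' / s"
        using s unfolding l dist_norm scaleR_diff_right[symmetric] norm_scaleR by (simp add: field_simps)
      moreover have "2 * \<rho> \<le> 1 / s" unfolding \<rho>_def using s R by (simp add: field_simps)
      ultimately show ?thesis using divide_right_mono[of 1 "dist l l'" s] s by linarith
    qed
    show "?A \<le> cmod (fourier_measure ?\<mu> (R *\<^sub>R \<omega>))" if "u \<in> U" "\<omega> \<in> ball u \<rho> \<inter> sphere 0 1" for u \<omega>
    proof -
      obtain l where l: "l \<in> L" "u = l /\<^sub>R s" using \<open>u \<in> U\<close> unfolding U_def by blast
      have fin: "finite_measure ?\<mu>"
        using M by (intro finite_measureI) (simp add: sets_eq_imp_space_eq[of _ borel])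
      have \<omega>: "norm \<omega> = 1" "norm (\<omega> - u) < \<rho>" using that by (auto simp: dist_norm norm_minus_commute)
      \<comment> \<open>Scaling by R carries u to the dual lattice point 2 pi h l and the cap of
        radius \<rho> into the ball of radius 1/2 around it.\<close>
      have "R *\<^sub>R \<omega> - (2 * pi * h) *\<^sub>R l = R *\<^sub>R (\<omega> - u)"
        using s unfolding l R_def by (simp add: algebra_simps)
      then have "norm (R *\<^sub>R \<omega> - (2 * pi * h) *\<^sub>R l) = R * norm (\<omega> - u)" using R by simp
      also have "\<dots> \<le> R * \<rho>" using \<omega> R by (intro mult_left_mono) auto
      finally have near: "norm (R *\<^sub>R \<omega> - (2 * pi * h) *\<^sub>R l) \<le> 1/2" using \<rho> by simp
      have "AE x in ?\<mu>. 1/2 \<le> cos (x \<bullet> (R *\<^sub>R \<omega>))"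
      proof (rule AE_ball_sum_measure)
        fix g x assume g: "g \<in> G" "dist g x < \<rho>"
        have "dist g x * norm (R *\<^sub>R \<omega>) \<le> \<rho> * R" using g R \<omega> by (auto intro: mult_right_mono)
        then have "dist g x * norm (R *\<^sub>R \<omega>) \<le> 1/2" using \<rho>(4) by (simp add: mult.commute)
        then show "1/2 \<le> cos (x \<bullet> (R *\<^sub>R \<omega>))"
          using g(1) G_grid norm_G[OF g(1)] h L(2) l(1) near
          by (intro cos_inner_near_lattice_ge[of g h l]) auto
      qed
      from cmod_fourier_measure_ge[OF fin _ this] show ?thesis
        using M by (simp add: D_def measure_def)
    qed
  qed
  then show thesis
    using \<open>alpha_dimensional \<alpha> ?\<mu>\<close> R NK_R R_le M c_dim L(6) cardU
    by (intro that[of ?\<mu> R M "card L"]) (auto simp: \<rho>_def M_def)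
qed

section \<open>Comparison of powers of R\<close>

text \<open>The assumed decay is tested on the measure just built. The mass and the ball volume
  cancel, and the number of caps is eliminated through its lower bound, so that only N, K and R
  remain.\<close>

lemma decay_admissible_estimate:
  fixes \<alpha> \<beta> C :: real and N K :: nat
  defines "D \<equiv> DIM('a::euclidean_space)"
  assumes \<alpha>: "0 < \<alpha>" "\<alpha> \<le> D" and N: "1 \<le> N" "1 \<le> K" and NK: "real N ^ D \<le> (real N * real K) powr \<alpha>"
    and C: "\<And>R (\<mu>::'a::euclidean_space measure). 1 < R \<Longrightarrow> alpha_dimensional \<alpha> \<mu> \<Longrightarrow>
        sphere_L2_sq (\<lambda>\<omega>. fourier_measure \<mu> (R *\<^sub>R \<omega>))
          \<le> ennreal C * c_dim \<alpha> \<mu> * emeasure \<mu> UNIV * ennreal (R powr (- \<beta>))"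
  defines "B \<equiv> \<bar>C\<bar> * 5 ^ D * (2 ^ D + (2 * real D) ^ D)"
    and "c \<equiv> unit_ball_vol D / 8 ^ D * ((2 * pi) powr (- real D / 2) / 2)\<^sup>2"
  obtains R where "real N * real K \<le> R" "R \<le> 8 * pi * real D ^ 2 * (real N * real K)"
    "c * (real N * real K) ^ D \<le> 4 * real D * (real K)\<^sup>2 * B * (2 ^ D * R powr (real D - 1 + \<alpha> - \<beta>))"
proof -
  obtain R M :: real and n :: nat and \<mu> :: "'a measure"
    where \<mu>: "alpha_dimensional \<alpha> \<mu>" "1 < R" "real N * real K \<le> R" "R \<le> 8 * pi * real D ^ 2 * (real N * real K)"
    "M = real N ^ D * (unit_ball_vol D * (1 / (2 * R)) ^ D)" "emeasure \<mu> UNIV = ennreal M"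
    "c_dim \<alpha> \<mu> \<le> ennreal (5 ^ D * (unit_ball_vol D * (1 / (2 * R)) ^ D) * ((2 ^ D + (2 * real D) ^ D) * R powr \<alpha>))"
    "ennreal (real n * (unit_ball_vol D / 8 ^ D * (1 / (2 * R)) ^ (D - 1)) * ((2 * pi) powr (- real D / 2) * (M / 2))\<^sup>2)
      \<le> sphere_L2_sq (\<lambda>\<omega>. fourier_measure \<mu> (R *\<^sub>R \<omega>))"
    "K ^ D \<le> 4 * D * K\<^sup>2 * n"
    by (rule lattice_ball_measure[where 'a = 'a, folded D_def, OF \<alpha> N NK])
  define v where "v = unit_ball_vol D * (1 / (2 * R)) ^ D"
  define F where "F = (2 ^ D + (2 * real D) ^ D) * R powr \<alpha>"
  define a where "a = (2 * pi) powr (- real D / 2) / 2"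
  define q where "q = unit_ball_vol D / 8 ^ D"
  have D: "1 \<le> D" using DIM_positive[where 'a = 'a] unfolding D_def by linarith
  have v: "0 < v" and F: "0 \<le> F" and M: "M = real N ^ D * v" "0 < M" and q: "0 \<le> q"
    using \<mu>(2,5) N by (auto simp: v_def F_def q_def)
  have "ennreal (real n * (q * (1 / (2 * R)) ^ (D - 1)) * (a * M)\<^sup>2)
      \<le> ennreal C * c_dim \<alpha> \<mu> * emeasure \<mu> UNIV * ennreal (R powr (- \<beta>))"
    using order.trans[OF \<mu>(8) C[OF \<mu>(2,1)]] by (simp add: a_def q_def)
  \<comment> \<open>A negative C is sent to 0 by \<open>ennreal\<close>; the absolute value makes
    all factors nonnegative for the passage to real numbers.\<close>
  also have "\<dots> \<le> ennreal \<bar>C\<bar> * ennreal (5 ^ D * v * F) * ennreal M * ennreal (R powr (- \<beta>))"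
    using \<mu>(7) unfolding \<mu>(6) v_def F_def by (intro mult_right_mono mult_mono ennreal_leI) auto
  also have "\<dots> = ennreal (\<bar>C\<bar> * (5 ^ D * v * F) * M * R powr (- \<beta>))"
    using v F M by (simp add: ennreal_mult)
  finally have "real n * (q * (1 / (2 * R)) ^ (D - 1)) * (a * M)\<^sup>2 \<le> \<bar>C\<bar> * (5 ^ D * v * F) * M * R powr (- \<beta>)"
    using v F M by (subst (asm) ennreal_le_iff) auto
  \<comment> \<open>The left side is quadratic in M, while the right side has one factor M and,
    through \<open>c_dim\<close>, one factor v. As M = N ^ D * v, cancelling v * M leaves N ^ D on
    the left.\<close>
  then have "(v * M) * (real n * (q * (1 / (2 * R)) ^ (D - 1)) * a\<^sup>2 * real N ^ D)
      \<le> (v * M) * (\<bar>C\<bar> * 5 ^ D * F * R powr (- \<beta>))"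
    unfolding power_mult_distrib power2_eq_square[of M] by (simp add: M(1) ac_simps)
  then have 1: "real n * (q * (1 / (2 * R)) ^ (D - 1)) * a\<^sup>2 * real N ^ D \<le> \<bar>C\<bar> * 5 ^ D * F * R powr (- \<beta>)"
    using v M by (subst (asm) mult_le_cancel_left_pos) auto
  have "real (K ^ D) \<le> real (4 * D * K\<^sup>2 * n)" using \<mu>(9) by (rule of_nat_mono)
  then have 2: "real K ^ D \<le> 4 * real D * (real K)\<^sup>2 * real n" by simp
  have "c * (real N * real K) ^ D = (q * a\<^sup>2 * real N ^ D) * real K ^ D"
    by (simp add: c_def q_def a_def power_mult_distrib)
  also have "\<dots> \<le> (q * a\<^sup>2 * real N ^ D) * (4 * real D * (real K)\<^sup>2 * real n)"
    using 2 q by (intro mult_left_mono) auto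
  \<comment> \<open>The factor \<open>(2 * R) ^ (D - 1)\<close> compensates for the size of a cap,
    which brings the left side of fact \<open>1\<close> into view.\<close>
  also have "\<dots> = 4 * real D * (real K)\<^sup>2 * (2 * R) ^ (D - 1) * (real n * (q * (1 / (2 * R)) ^ (D - 1)) * a\<^sup>2 * real N ^ D)"
    using \<mu>(2) by (simp add: power_divide)
  also have "\<dots> \<le> 4 * real D * (real K)\<^sup>2 * (2 * R) ^ (D - 1) * (\<bar>C\<bar> * 5 ^ D * F * R powr (- \<beta>))"
    using 1 \<mu>(2) by (intro mult_left_mono) auto
  also have "\<dots> = 4 * real D * (real K)\<^sup>2 * B * (2 ^ (D - 1) * (R ^ (D - 1) * R powr \<alpha> * R powr (- \<beta>)))"
    by (simp add: B_def F_def power_mult_distrib)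
  also have "R ^ (D - 1) * R powr \<alpha> * R powr (- \<beta>) = R powr (real D - 1 + \<alpha> - \<beta>)"
  proof -
    have "R ^ (D - 1) = R powr (real D - 1)" using \<mu>(2) D by (simp add: powr_realpow[symmetric] of_nat_diff)
    then show ?thesis by (simp add: powr_add[symmetric])
  qed
  also have "4 * real D * (real K)\<^sup>2 * B * (2 ^ (D - 1) * R powr (real D - 1 + \<alpha> - \<beta>)) \<le>
      4 * real D * (real K)\<^sup>2 * B * (2 ^ D * R powr (real D - 1 + \<alpha> - \<beta>))"
    by (intro mult_left_mono mult_right_mono power_increasing) (auto simp: B_def)
  finally show thesis using that \<mu>(3,4) by blast
qed

text \<open>An admissible exponent exceeding the bound by \<gamma> > 0 would force R powr \<gamma>
  \<le> H with H fixed, for arbitrarily large R. The key is that K ^ 2 is at most a constant times R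
  powr (2 - 2 * \<alpha> / D), since R is of order N K and N ^ D of order R powr \<alpha>.\<close>

lemma decay_admissible_le:
  fixes \<alpha> \<beta> :: real
  defines "D \<equiv> DIM('a::euclidean_space)"
  assumes \<alpha>: "0 < \<alpha>" "\<alpha> \<le> D" and adm: "decay_admissible TYPE('a::euclidean_space) \<alpha> \<beta>"
  shows "\<beta> \<le> \<alpha> - 1 + 2 * (D - \<alpha>) / D"
proof (rule ccontr)
  define \<gamma> where "\<gamma> = \<beta> - (\<alpha> - 1 + 2 * (D - \<alpha>) / D)"
  assume "\<not> ?thesis"
  then have \<gamma>: "0 < \<gamma>" by (simp add: \<gamma>_def)
  have D: "1 \<le> D" using DIM_positive[where 'a = 'a] unfolding D_def by linarith
  obtain C where C: "\<And>R (\<mu>::'a measure). 1 < R \<Longrightarrow> alpha_dimensional \<alpha> \<mu> \<Longrightarrow>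
        sphere_L2_sq (\<lambda>\<omega>. fourier_measure \<mu> (R *\<^sub>R \<omega>))
          \<le> ennreal C * c_dim \<alpha> \<mu> * emeasure \<mu> UNIV * ennreal (R powr (- \<beta>))"
    using adm unfolding decay_admissible_def by blast
  define B where "B = \<bar>C\<bar> * 5 ^ D * (2 ^ D + (2 * real D) ^ D)"
  define c where "c = unit_ball_vol D / 8 ^ D * ((2 * pi) powr (- real D / 2) / 2)\<^sup>2"
  define E where "E = 8 * pi * real D ^ 2"
  \<comment> \<open>The constant of the final chain. It involves only D, \<alpha> and C, so N may be
    chosen after it.\<close>
  define H where "H = 4 * real D * B * 2 ^ D * (2 * E) powr (2 * \<alpha> / D) * E ^ D / c"
  have c: "0 < c" and B: "0 \<le> B" and E: "0 < E" using D by (auto simp: c_def B_def E_def)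
  \<comment> \<open>Large enough that N powr \<gamma> is at least \<open>\<bar>H\<bar> + 1\<close>;
    since N \<le> S \<le> R this contradicts the final bound. The base being at least 1 also gives 1
    \<le> N.\<close>
  define N where "N = nat \<lceil>(\<bar>H\<bar> + 1) powr (1 / \<gamma>)\<rceil>"
  \<comment> \<open>\<open>R\<close> has order \<open>N K\<close>, and this choice of \<open>K\<close> makes \<open>N ^ D\<close> of order \<open>R powr \<alpha>\<close>.\<close>
  define K where "K = nat \<lceil>real N powr (D / \<alpha> - 1)\<rceil>"
  have N_ge: "(\<bar>H\<bar> + 1) powr (1 / \<gamma>) \<le> N" unfolding N_def by linarith
  moreover have "1 \<le> (\<bar>H\<bar> + 1) powr (1 / \<gamma>)" using \<gamma> by (intro ge_one_powr_ge_zero) auto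
  ultimately have N: "1 \<le> real N" by linarith
  \<comment> \<open>The exponent is nonnegative as \<alpha> \<le> D, and rounding up a number that
    is at least 1 at most doubles it.\<close>
  have "1 \<le> real N powr (D / \<alpha> - 1)" using N \<alpha> by (intro ge_one_powr_ge_zero) auto
  then have K: "real N powr (D / \<alpha> - 1) \<le> K" "K \<le> 2 * real N powr (D / \<alpha> - 1)" "1 \<le> real K"
    unfolding K_def by linarith+
  define S where "S = real N * real K"
  have N_eq: "real N * real N powr (D / \<alpha> - 1) = real N powr (D / \<alpha>)"
    using N by (simp add: powr_diff)
  have NDa: "(real N powr (D / \<alpha>)) powr \<alpha> = real N ^ D"
    using N \<alpha> by (simp add: powr_powr powr_realpow)
  have "real N powr (D / \<alpha>) \<le> S"
    unfolding S_def N_eq[symmetric] using K N by (intro mult_left_mono) auto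
  then have NS: "real N ^ D \<le> S powr \<alpha>"
    unfolding NDa[symmetric] using \<alpha> by (intro powr_mono2) auto
  have "S / 2 \<le> real N powr (D / \<alpha>)"
    unfolding S_def N_eq[symmetric] using K N by simp
  then have "(S / 2) powr \<alpha> \<le> real N ^ D"
    unfolding NDa[symmetric] using \<alpha> by (intro powr_mono2) (auto simp: S_def)
  \<comment> \<open>Raising to the power 2 / D gives a lower bound for N ^ 2, to be divided out of S
    ^ 2 = K ^ 2 * N ^ 2.\<close>
  then have "((S / 2) powr \<alpha>) powr (2 / D) \<le> (real N ^ D) powr (2 / D)"
    using D by (intro powr_mono2) auto
  also have "\<dots> = (real N)\<^sup>2"
  proof -
    have "(real N ^ D) powr (2 / D) = (real N powr D) powr (2 / D)" using N by (simp add: powr_realpow)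
    also have "\<dots> = real N powr 2" using D by (simp only: powr_powr) simp
    finally show ?thesis using N by simp
  qed
  finally have SN: "(S / 2) powr (2 * \<alpha> / D) \<le> (real N)\<^sup>2" by (simp add: powr_powr mult.commute)
  have NK1: "1 \<le> N" "1 \<le> K" using N K(3) by simp_all
  obtain R where R: "S \<le> R" "R \<le> E * S"
    "c * S ^ D \<le> 4 * real D * (real K)\<^sup>2 * B * (2 ^ D * R powr (real D - 1 + \<alpha> - \<beta>))"
    unfolding S_def E_def c_def B_def
    by (rule decay_admissible_estimate[where 'a = 'a, folded D_def, OF \<alpha> NK1 NS[unfolded S_def] C])
  have "real N * 1 \<le> S" unfolding S_def using K(3) by (intro mult_left_mono) auto
  then have S: "N \<le> S" "1 \<le> S" using N by linarith+
  have R1: "1 \<le> R" using S R by linarith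
  have "(R / (2 * E)) powr (2 * \<alpha> / D) \<le> (S / 2) powr (2 * \<alpha> / D)"
    using R(2) R1 E \<alpha> by (intro powr_mono2) (auto simp: field_simps)
  with SN have RN: "(R / (2 * E)) powr (2 * \<alpha> / D) \<le> (real N)\<^sup>2" by linarith
  have "(real K)\<^sup>2 * (R / (2 * E)) powr (2 * \<alpha> / D) \<le> (real K)\<^sup>2 * (real N)\<^sup>2"
    by (intro mult_left_mono RN) auto
  also have "\<dots> = S\<^sup>2" by (simp add: S_def power_mult_distrib)
  also have "\<dots> \<le> R\<^sup>2" using R S by (intro power_mono) auto
  finally have "(real K)\<^sup>2 * R powr (2 * \<alpha> / D) \<le> R\<^sup>2 * (2 * E) powr (2 * \<alpha> / D)"
    using R1 E by (simp add: powr_divide field_simps)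
  then have KR: "(real K)\<^sup>2 \<le> (2 * E) powr (2 * \<alpha> / D) * R powr (2 - 2 * \<alpha> / D)"
    using R1 by (simp add: powr_diff field_simps)
  \<comment> \<open>Replacing S by R on the left costs only the constant E ^ D.\<close>
  have "c * R ^ D \<le> c * (E * S) ^ D" using R R1 c by (intro mult_left_mono power_mono) auto
  also have "\<dots> = E ^ D * (c * S ^ D)" by (simp add: power_mult_distrib)
  also have "\<dots> \<le> E ^ D * (4 * real D * (real K)\<^sup>2 * B * (2 ^ D * R powr (real D - 1 + \<alpha> - \<beta>)))"
    using R(3) E by (intro mult_left_mono) auto
  also have "\<dots> \<le> E ^ D * (4 * real D * ((2 * E) powr (2 * \<alpha> / D) * R powr (2 - 2 * \<alpha> / D)) * B * (2 ^ D * R powr (real D - 1 + \<alpha> - \<beta>)))"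
    using KR E B by (intro mult_left_mono mult_right_mono) auto
  also have "\<dots> = c * (H * (R powr (2 - 2 * \<alpha> / D) * R powr (real D - 1 + \<alpha> - \<beta>)))"
    using c by (simp add: H_def)
  \<comment> \<open>The exponents add up to D minus the excess \<gamma>, by the definition of
    \<gamma>.\<close>
  also have "R powr (2 - 2 * \<alpha> / D) * R powr (real D - 1 + \<alpha> - \<beta>) = R powr (D - \<gamma>)"
    using D by (simp add: \<gamma>_def powr_add[symmetric] diff_divide_distrib algebra_simps)
  also have "R powr (D - \<gamma>) = R ^ D / R powr \<gamma>" using R1 by (simp add: powr_diff powr_realpow)
  finally have "R ^ D \<le> H * (R ^ D / R powr \<gamma>)"
    using c by (subst (asm) mult_le_cancel_left_pos) auto
  then have "R powr \<gamma> \<le> H" using R1 by (simp add: field_simps)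
  moreover have "\<bar>H\<bar> + 1 = ((\<bar>H\<bar> + 1) powr (1 / \<gamma>)) powr \<gamma>" using \<gamma> by (simp add: powr_powr)
  moreover have "\<dots> \<le> R powr \<gamma>"
    using N_ge S R \<gamma> by (intro powr_mono2) auto
  ultimately show False by linarith
qed

theorem theorem1p3:
  fixes \<alpha> :: real
  assumes "CARD('n::finite) \<ge> 4" and "0 < \<alpha>" and "\<alpha> \<le> real CARD('n)"
  shows "beta_exponent TYPE(real ^ 'n) \<alpha>
    \<le> ereal (\<alpha> - 1 + 2 * (real CARD('n) - \<alpha>) / real CARD('n))"
  unfolding beta_exponent_def
proof (rule SUP_least)
  fix \<beta> assume "\<beta> \<in> {\<beta>. decay_admissible TYPE(real ^ 'n) \<alpha> \<beta>}"
  then show "ereal \<beta> \<le> ereal (\<alpha> - 1 + 2 * (real CARD('n) - \<alpha>) / real CARD('n))"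
    using decay_admissible_le[where 'a = "real ^ 'n", of \<alpha> \<beta>] assms by simp
qed

end
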